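(* Let $a,b,c$ be commuting indeterminates and let $D$ be the derivation of $\mathbb{Q}[a,b,c]$ determined by $D(a)=a^2b^2$, $D(b)=b^3c^2$, $D(c)=b^2c^3$. For $0\le k\le n$ let $T(n,k)=\binom{n+k}{k}\frac{n-k+1}{n+1}$ (the ballot numbers of the Catalan triangle). Then for all $n\ge0$, $$D^n(a^2b^2)=(n+1)!\,a^2b^{2n+2}\sum_{k=0}^nT(n,k)a^{n-k}c^{2k}.$$
   Context: $D$ is the formal derivative of the context-free grammar $\{a\rightarrow a^2b^2, b\rightarrow b^3c^2, c\rightarrow b^2c^3\}$, i.e. a linear map satisfying the Leibniz rule $D(uv)=D(u)v+uD(v)$; $D^0$ is the identity. *)

theory Defs
  imports Complex_Main "HOL-Library.Poly_Mapping"
begin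

datatype indet = A | B | C

text \<open>Elements of the polynomial ring \<open>\<rat>[a,b,c]\<close>: finitely supported maps from exponent vectors to
  coefficients, multiplied by convolution.\<close>

type_synonym qpoly = "(indet \<Rightarrow>\<^sub>0 nat) \<Rightarrow>\<^sub>0 rat"

definition Const :: "rat \<Rightarrow> qpoly"
  where "Const r = Poly_Mapping.single 0 r"

definition X :: "indet \<Rightarrow> qpoly"
  where "X v = Poly_Mapping.single (Poly_Mapping.single v 1) 1"

definition derivation :: "(qpoly \<Rightarrow> qpoly) \<Rightarrow> bool"
  where "derivation D \<longleftrightarrow>
    (\<forall>u v. D (u + v) = D u + D v) \<and>
    (\<forall>r u. D (Const r * u) = Const r * D u) \<and>
    (\<forall>u v. D (u * v) = D u * v + u * D v)"

definition grammar_derivation :: "(qpoly \<Rightarrow> qpoly) \<Rightarrow> bool"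
  where "grammar_derivation D \<longleftrightarrow>
    derivation D \<and>
    D (X A) = X A ^ 2 * X B ^ 2 \<and>
    D (X B) = X B ^ 3 * X C ^ 2 \<and>
    D (X C) = X B ^ 2 * X C ^ 3"

definition ballot :: "nat \<Rightarrow> nat \<Rightarrow> rat"
  where "ballot n k = of_nat ((n + k) choose k) * ((of_nat n - of_nat k + 1) / (of_nat n + 1))"


text \<open>The predicate \<^const>\<open>grammar_derivation\<close> holds of exactly one map. Existence is shown by extending
  \<open>mono_deriv\<close> linearly from monomials.\<close>

lemma qpoly_induct [case_names single add]:
  assumes "\<And>m r. P (Poly_Mapping.single m r)" "\<And>p q. P p \<Longrightarrow> P q \<Longrightarrow> P (p + q)"
  shows "P (p :: qpoly)"
proof (induction p rule: Poly_Mapping.update_induct)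
  case const
  show ?case using assms(1)[of 0 0] by simp
next
  case (update f m r)
  have "Poly_Mapping.update m r f = f + Poly_Mapping.single m r"
    using update(1) by (intro poly_mapping_eqI)
      (auto simp: lookup_update lookup_add lookup_single when_def in_keys_iff)
  then show ?case using update assms by simp
qed

lemma X_power: "X v ^ i = Poly_Mapping.single (Poly_Mapping.single v i) 1"
  by (induction i) (simp_all add: X_def mult_single flip: single_add)

lemma single_conv_X:
  "Poly_Mapping.single m r =
     Const r * (X A ^ Poly_Mapping.lookup m A * X B ^ Poly_Mapping.lookup m B *
       X C ^ Poly_Mapping.lookup m C)"
proof -
  have "m = Poly_Mapping.single A (Poly_Mapping.lookup m A)
      + Poly_Mapping.single B (Poly_Mapping.lookup m B)
      + Poly_Mapping.single C (Poly_Mapping.lookup m C)" (is "_ = ?s")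
  proof (rule poly_mapping_eqI)
    fix v show "Poly_Mapping.lookup m v = Poly_Mapping.lookup ?s v"
      by (cases v) (simp_all add: lookup_add lookup_single)
  qed
  then show ?thesis
    unfolding X_power Const_def by (simp add: mult_single)
qed

lemma derivation_Const:
  assumes "derivation D" shows "D (Const r) = 0"
proof -
  have "D (1 * 1) = D 1 * 1 + 1 * D 1" using assms unfolding derivation_def by blast
  then have "D 1 = 0" by simp
  moreover have "D (Const r * 1) = Const r * D 1" using assms unfolding derivation_def by blast
  ultimately show ?thesis by simp
qed

lemma derivation_unique:
  assumes D: "derivation D" and E: "derivation E" and eq: "\<And>v. D (X v) = E (X v)"
  shows "D = E"
proof
  have m: "D (u * v) = D u * v + u * D v" "E (u * v) = E u * v + u * E v" for u v
    using D E unfolding derivation_def by blast+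
  have a: "D (u + v) = D u + D v" "E (u + v) = E u + E v" for u v
    using D E unfolding derivation_def by blast+
  have s: "D (Const r * u) = Const r * D u" "E (Const r * u) = Const r * E u" for r u
    using D E unfolding derivation_def by blast+
  have one: "D 1 = 0" "E 1 = 0"
    using derivation_Const[OF D, of 1] derivation_Const[OF E, of 1] by (simp_all add: Const_def)
  have pow: "D (X v ^ i) = E (X v ^ i)" for v i
    by (induction i) (simp_all add: m one eq)
  fix p show "D p = E p"
  proof (induction p rule: qpoly_induct)
    case (single m r)
    show ?case by (simp only: single_conv_X s) (simp only: m pow)
  next
    case (add p q)
    then show ?case by (simp add: a)
  qed
qed

definition mono_deriv :: "(indet \<Rightarrow> qpoly) \<Rightarrow> (indet \<Rightarrow>\<^sub>0 nat) \<Rightarrow> qpoly"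
  where "mono_deriv G m = (\<Sum>v\<in>{A, B, C}. Poly_Mapping.single (m - Poly_Mapping.single v 1)
    (of_nat (Poly_Mapping.lookup m v)) * G v)"

lemma mono_deriv_add:
  "mono_deriv G (m + m') =
     mono_deriv G m * Poly_Mapping.single m' 1 + Poly_Mapping.single m 1 * mono_deriv G m'"
proof -
  have *: "Poly_Mapping.single (m + m' - Poly_Mapping.single v 1) (of_nat (Poly_Mapping.lookup m v) :: rat)
     = Poly_Mapping.single (m - Poly_Mapping.single v 1) (of_nat (Poly_Mapping.lookup m v))
       * Poly_Mapping.single m' 1" for m m' :: "indet \<Rightarrow>\<^sub>0 nat" and v
  proof (cases "Poly_Mapping.lookup m v = 0")
    case False
    then have "m + m' - Poly_Mapping.single v 1 = m - Poly_Mapping.single v 1 + m'"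
      by (intro poly_mapping_eqI) (auto simp: lookup_add lookup_minus lookup_single when_def)
    then show ?thesis by (simp add: mult_single)
  qed simp
  have "Poly_Mapping.single (m + m' - Poly_Mapping.single v 1)
      (of_nat (Poly_Mapping.lookup (m + m') v) :: rat) * g
     = Poly_Mapping.single (m - Poly_Mapping.single v 1) (of_nat (Poly_Mapping.lookup m v)) * g
         * Poly_Mapping.single m' 1
       + Poly_Mapping.single m 1 *
         (Poly_Mapping.single (m' - Poly_Mapping.single v 1) (of_nat (Poly_Mapping.lookup m' v)) * g)"
    for v g
    using *[of m m' v] *[of m' m v]
    by (simp add: lookup_add single_add algebra_simps)
  then show ?thesis
    unfolding mono_deriv_def sum_distrib_left sum_distrib_right sum.distrib[symmetric] by simp
qed

lemma derivation_exists: "\<exists>D. derivation D \<and> (\<forall>v. D (X v) = G v)"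
proof -
  define D where
    "D p = (\<Sum>m\<in>Poly_Mapping.keys p. Const (Poly_Mapping.lookup p m) * mono_deriv G m)" for p
  have add: "D (u + v) = D u + D v" for u v
    unfolding D_def
    by (rule setsum_keys_plus_distrib) (simp_all add: Const_def single_add distrib_right)
  have D_single: "D (Poly_Mapping.single m r) = Const r * mono_deriv G m" for m r
    by (simp add: D_def Const_def)
  have scale: "D (Const r * u) = Const r * D u" for r u
  proof (induction u rule: qpoly_induct)
    case (single m s)
    have "Const r * Poly_Mapping.single m s = Poly_Mapping.single m (r * s)"
      "Const (r * s) = Const r * Const s" by (simp_all add: Const_def mult_single)
    then show ?case by (simp add: D_single mult.assoc)
  qed (simp add: add distrib_left)
  have leibniz: "D (u * v) = D u * v + u * D v" for u v
  proof (induction u rule: qpoly_induct)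
    case u: (single m r)
    show ?case
    proof (induction v rule: qpoly_induct)
      case v: (single m' s)
      have 1: "Const (r * s) = Const r * Const s" by (simp add: Const_def mult_single)
      have 2: "Poly_Mapping.single k t = Const t * Poly_Mapping.single k 1" for k t
        by (simp add: Const_def mult_single)
      have "D (Poly_Mapping.single m r * Poly_Mapping.single m' s)
          = Const r * Const s * mono_deriv G (m + m')"
        by (simp add: mult_single D_single 1)
      also have "\<dots> = (Const r * mono_deriv G m) * (Const s * Poly_Mapping.single m' 1)
          + (Const r * Poly_Mapping.single m 1) * (Const s * mono_deriv G m')"
        by (simp add: mono_deriv_add algebra_simps)
      finally show ?case
        by (simp only: D_single 2[of m r, symmetric] 2[of m' s, symmetric])
    qed (simp add: add algebra_simps)
  qed (simp add: add algebra_simps)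
  have "D (X v) = G v" for v
    unfolding X_def D_single mono_deriv_def
    by (cases v) (simp_all add: Const_def lookup_single)
  then show ?thesis
    using add scale leibniz unfolding derivation_def by blast
qed

lemma grammar_derivation_ex1: "\<exists>!D. grammar_derivation D"
proof -
  define G where "G = case_indet (X A ^ 2 * X B ^ 2) (X B ^ 3 * X C ^ 2) (X B ^ 2 * X C ^ 3)"
  have *: "grammar_derivation D \<longleftrightarrow> derivation D \<and> (\<forall>v. D (X v) = G v)" for D
    unfolding grammar_derivation_def G_def 
    by (auto split: indet.split)
  obtain D where "derivation D \<and> (\<forall>v. D (X v) = G v)" using derivation_exists by blast
  then show ?thesis
    unfolding * using derivation_unique by (intro ex1I[of _ D]) auto
qed

end

theory Submission
  imports Defs
begin

text \<open>Induction on \<open>n\<close>. Since \<open>D(a^i b^j c^m) = i a^(i+1) b^(j+2) c^m + (j+m) a^i b^(j+2) c^(m+2)\<close>,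
  comparing coefficients reduces the step to
  \<open>(n+2) T(n+1,k+1) = (n+1-k) T(n,k+1) + 2(n+k+1) T(n,k)\<close>. This also holds at the boundary \<open>k = n\<close>,
  where the formula gives \<open>T(n,n+1) = 0\<close>.\<close>

lemma Const_0 [simp]: "Const 0 = 0"
  and Const_1 [simp]: "Const 1 = 1"
  and Const_add: "Const (r + s) = Const r + Const s"
  and Const_mult: "Const (r * s) = Const r * Const s"
  by (simp_all add: Const_def single_add mult_single)

lemma Const_of_nat: "Const (of_nat n) = of_nat n"
  by (induction n) (simp_all add: Const_add)

text \<open>Stated for \<open>Suc n\<close>, so that no truncated exponent \<open>n - 1\<close>
  occurs.\<close>

lemma derivation_power:
  assumes "derivation D"
  shows "D (u ^ Suc n) = of_nat (Suc n) * u ^ n * D u"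
proof (induction n)
  case (Suc n)
  have "D (u ^ Suc (Suc n)) = D u * u ^ Suc n + u * D (u ^ Suc n)"
    using assms unfolding derivation_def power_Suc[of u "Suc n"] by blast
  then show ?case
    by (simp only: Suc.IH) (simp add: algebra_simps)
qed simp

lemma derivation_sum:
  assumes "derivation D"
  shows "D (sum f S) = (\<Sum>i\<in>S. D (f i))"
proof -
  have "D 0 = 0"
    using derivation_Const[OF assms, of 0] by simp
  moreover have "D (u + v) = D u + D v" for u v
    using assms unfolding derivation_def by blast
  ultimately show ?thesis
    by (induction S rule: infinite_finite_induct) simp_all
qed

text \<open>The logarithmic derivatives are \<open>D(a)/a = a b^2\<close> and
  \<open>D(b)/b = D(c)/c = b^2 c^2\<close>. As \<open>b\<close> and \<open>c\<close> share theirs,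
  their exponents merge into the single factor \<open>j + m\<close>.\<close>

lemma grammar_derivation_monomial:
  assumes "grammar_derivation D"
  shows "D (X A ^ i * X B ^ j * X C ^ m) =
    of_nat i * (X A ^ Suc i * X B ^ (j + 2) * X C ^ m) +
    of_nat (j + m) * (X A ^ i * X B ^ (j + 2) * X C ^ (m + 2))"
proof -
  have D: "derivation D" and DX: "D (X A) = X A ^ 2 * X B ^ 2"
    "D (X B) = X B ^ 3 * X C ^ 2" "D (X C) = X B ^ 2 * X C ^ 3"
    using assms by (auto simp: grammar_derivation_def)
  have leibniz: "D (u * v) = D u * v + u * D v" for u v
    using D unfolding derivation_def by blast
  have D1: "D 1 = 0"
    using derivation_Const[OF D, of 1] by simp
  have "D (X A ^ i) = of_nat i * (X A ^ Suc i * X B ^ 2)"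
    by (cases i) (simp_all only: derivation_power[OF D] DX, simp_all add: D1 power2_eq_square algebra_simps)
  moreover have "D (X B ^ j) = of_nat j * (X B ^ (j + 2) * X C ^ 2)"
    by (cases j)
      (simp_all only: derivation_power[OF D] DX, simp_all add: D1 power2_eq_square power3_eq_cube algebra_simps)
  moreover have "D (X C ^ m) = of_nat m * (X B ^ 2 * X C ^ (m + 2))"
    by (cases m)
      (simp_all only: derivation_power[OF D] DX, simp_all add: D1 power2_eq_square power3_eq_cube algebra_simps)
  ultimately show ?thesis
    by (simp add: leibniz power_add power2_eq_square algebra_simps)
qed

text \<open>The factor \<open>n - (n + 1) + 1\<close>, computed in the rationals, is zero. This
  permits one extra summand in the induction step.\<close>

lemma ballot_Suc_right_eq_0: "ballot n (Suc n) = 0"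
  by (simp add: ballot_def)

lemma ballot_0_right: "ballot n 0 = 1"
  using of_nat_neq_0[of n] by (simp add: ballot_def add.commute)

lemma ballot_Suc_Suc:
  "of_nat (n + 2) * ballot (Suc n) (Suc k) =
    (of_nat (Suc n) - of_nat k) * ballot n (Suc k) + 2 * of_nat (n + k + 1) * ballot n k"
proof -
  define x y b c d :: rat where "x = of_nat n" and "y = of_nat k"
    and "b = of_nat ((n + k) choose k)" and "c = of_nat (Suc (n + k) choose Suc k)"
    and "d = of_nat (Suc (Suc (n + k)) choose Suc k)"
  note defs = this
  \<comment> \<open>The three ballot numbers involve the neighbouring binomials \<open>b\<close>,
    \<open>c\<close>, \<open>d\<close>; two absorption identities express \<open>b\<close> and
    \<open>d\<close> through \<open>c\<close>.\<close>
  have "Suc k * (Suc (n + k) choose Suc k) = Suc (n + k) * ((n + k) choose k)"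
    by (rule Suc_times_binomial)
  from arg_cong[OF this, of "of_nat :: nat \<Rightarrow> rat"]
  have b: "(x + y + 1) * b = (y + 1) * c"
    by (simp add: defs algebra_simps)
  have "Suc n * (Suc (Suc (n + k)) choose Suc k) = Suc (Suc (n + k)) * (Suc (n + k) choose Suc k)"
    using binomial_absorb_comp[of "Suc (Suc (n + k))" "Suc k"] by (simp add: Suc_diff_le)
  from arg_cong[OF this, of "of_nat :: nat \<Rightarrow> rat"]
  have d: "(x + 1) * d = (x + y + 2) * c"
    by (simp add: defs algebra_simps)
  have nz: "x + 1 \<noteq> 0" "x + 2 \<noteq> 0"
    using of_nat_neq_0[of n] of_nat_neq_0[of "Suc n"] by (simp_all add: x_def algebra_simps)
  have ballot: "ballot (Suc n) (Suc k) = d * ((x - y + 1) / (x + 2))"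
    "ballot n (Suc k) = c * ((x - y) / (x + 1))" "ballot n k = b * ((x - y + 1) / (x + 1))"
    by (simp_all add: ballot_def defs algebra_simps)
  \<comment> \<open>Both sides are now multiples of \<open>c * (x - y + 1)\<close>, and the
    cofactors agree: \<open>x + y + 2 = (x - y) + 2 * (y + 1)\<close>.\<close>
  have "(x + 1) * d * (x - y + 1) = (x + 1 - y) * c * (x - y) + 2 * ((x + y + 1) * b) * (x - y + 1)"
    unfolding b d by (simp add: algebra_simps)
  then have "d * (x - y + 1) = ((x + 1 - y) * c * (x - y) + 2 * ((x + y + 1) * b) * (x - y + 1)) / (x + 1)"
    using nz(1) by (simp add: eq_divide_eq mult.assoc mult.commute mult.left_commute)
  also have "\<dots> = (x + 1 - y) * (c * ((x - y) / (x + 1))) + 2 * (x + y + 1) * (b * ((x - y + 1) / (x + 1)))"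
    by (simp only: add_divide_distrib[of "_ * _"] times_divide_eq_right mult.assoc)
  finally show ?thesis
    unfolding ballot using nz(2) by (simp add: x_def y_def add.commute)
qed

text \<open>All common factors are moved inside the sum, so that each summand is a constant times a
  monomial and the monomial rule applies to it.\<close>

lemma grammar_derivation_funpow:
  assumes "grammar_derivation D"
  shows "(D ^^ n) (X A ^ 2 * X B ^ 2) =
    (\<Sum>k\<le>n. Const (fact (n + 1) * ballot n k) * (X A ^ (n - k + 2) * X B ^ (2 * n + 2) * X C ^ (2 * k)))"
proof (induction n)
  case 0
  show ?case by (simp add: ballot_def power2_eq_square)
next
  case (Suc n)
  have D: "derivation D"
    using assms by (simp add: grammar_derivation_def)
  have scale: "D (Const r * u) = Const r * D u" for r u
    using D unfolding derivation_def by blast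
  \<comment> \<open>\<open>M k\<close> is the monomial of index \<open>k\<close> at stage
    \<open>Suc n\<close>. Differentiating summand \<open>k\<close> of stage \<open>n\<close> gives
    \<open>p k\<close> times \<open>M k\<close>, from the exponent of \<open>a\<close>, plus
    \<open>q k\<close> times \<open>M (Suc k)\<close>, from the exponents of \<open>b\<close> and
    \<open>c\<close>.\<close>
  define c :: "nat \<Rightarrow> nat \<Rightarrow> rat" where "c n k = fact (n + 1) * ballot n k" for n k
  define M where "M k = X A ^ (Suc n - k + 2) * X B ^ (2 * Suc n + 2) * X C ^ (2 * k)" for k
  define p where "p k = (of_nat (n + 2) - of_nat k) * c n k" for k
  define q where "q k = 2 * of_nat (n + k + 1) * c n k" for k
  \<comment> \<open>\<open>M 0\<close> receives no \<open>q\<close> term; both sides are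
    \<open>(n + 2)!\<close>.\<close>
  have c0: "c (Suc n) 0 = p 0"
    by (simp add: c_def p_def ballot_0_right algebra_simps)
  have cS: "c (Suc n) (Suc k) = p (Suc k) + q k" for k
  proof -
    \<comment> \<open>Splitting \<open>n + 2\<close> off the factorial produces the left side of the
      ballot recurrence.\<close>
    have "c (Suc n) (Suc k) = fact (n + 1) * (of_nat (n + 2) * ballot (Suc n) (Suc k))"
      by (simp add: c_def algebra_simps)
    then show ?thesis
      unfolding ballot_Suc_Suc by (simp add: p_def q_def c_def algebra_simps)
  qed
  have D_summand: "D (Const (c n k) * (X A ^ (n - k + 2) * X B ^ (2 * n + 2) * X C ^ (2 * k)))
      = Const (p k) * M k + Const (q k) * M (Suc k)" if "k \<le> n" for k
  proof -
    have "p k = c n k * of_nat (n - k + 2)" "q k = c n k * of_nat (2 * n + 2 + 2 * k)"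
      using that by (simp_all add: p_def q_def of_nat_diff algebra_simps)
    then have "Const (p k) = Const (c n k) * of_nat (n - k + 2)"
      "Const (q k) = Const (c n k) * of_nat (2 * n + 2 + 2 * k)"
      by (simp_all only: Const_mult Const_of_nat)
    moreover have "M k = X A ^ Suc (n - k + 2) * X B ^ (2 * n + 2 + 2) * X C ^ (2 * k)"
      "M (Suc k) = X A ^ (n - k + 2) * X B ^ (2 * n + 2 + 2) * X C ^ (2 * k + 2)"
      using that by (simp_all add: M_def Suc_diff_le)
    ultimately show ?thesis
      by (simp only: scale grammar_derivation_monomial[OF assms])
        (simp only: distrib_left mult.assoc)
  qed
  have "(D ^^ Suc n) (X A ^ 2 * X B ^ 2)
      = (\<Sum>k\<le>n. Const (p k) * M k + Const (q k) * M (Suc k))"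
    by (simp only: funpow.simps o_apply Suc.IH derivation_sum[OF D] c_def[symmetric])
      (intro sum.cong refl, simp only: D_summand atMost_iff)
  \<comment> \<open>The added summand is zero, because \<open>p (Suc n)\<close> contains
    \<open>ballot n (Suc n)\<close>.\<close>
  also have "\<dots> = (\<Sum>k\<le>Suc n. Const (p k) * M k) + (\<Sum>k\<le>n. Const (q k) * M (Suc k))"
    by (simp add: sum.distrib p_def c_def ballot_Suc_right_eq_0)
  \<comment> \<open>Splitting off index 0 aligns the \<open>p\<close> sum with the shifted
    \<open>q\<close> sum, and \<open>cS\<close> merges them termwise.\<close>
  also have "\<dots> = (\<Sum>k\<le>Suc n. Const (c (Suc n) k) * M k)"
    unfolding sum.atMost_Suc_shift cS c0 Const_add by (simp add: distrib_right sum.distrib)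
  finally show ?case
    by (simp only: M_def c_def)
qed

theorem theorem5:
  fixes D :: "qpoly \<Rightarrow> qpoly" and n :: nat
  assumes "grammar_derivation D"
  shows "(D ^^ n) (X A ^ 2 * X B ^ 2) =
    fact (n + 1) * X A ^ 2 * X B ^ (2 * n + 2) *
      (\<Sum>k = 0..n. Const (ballot n k) * X A ^ (n - k) * X C ^ (2 * k))"
proof -
  \<comment> \<open>The left factorial is rational, the right one is taken in the polynomial ring,
    as in the goal.\<close>
  have "Const (fact (n + 1)) = fact (n + 1)"
    using Const_of_nat[of "fact (n + 1)"] by (simp only: of_nat_fact)
  then show ?thesis
    unfolding grammar_derivation_funpow[OF assms] sum_distrib_left atMost_atLeast0
    by (intro sum.cong refl) (simp only: Const_mult power_add mult.assoc mult.left_commute mult.commute)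
qed

end
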